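(* Let $n\ge1$ and let $\mathcal{T}\in\mathcal{PT}_n^B$ be a permutation tableau of type $B$ of length $n$. Then $$\mathrm{al}_{nest}(\zeta(\mathcal{T}))=\mathrm{zero}_{EE}(\mathcal{T})+\mathrm{zero}_{NN}(\mathcal{T}),\qquad \mathrm{al}_{EN}(\zeta(\mathcal{T}))=\mathrm{zero}_{EN}(\mathcal{T}),\qquad \mathrm{al}_{NE}(\zeta(\mathcal{T}))=\mathrm{two}(\mathcal{T}).$$
   Context: Signed permutations. $[n]=\{1,\dots,n\}$, $[\pm n]=\{\pm1,\dots,\pm n\}$. $\mathfrak{S}_n^B$ is the group of permutations $\sigma$ of $[\pm n]$ with $\sigma(-i)=-\sigma(i)$. $\mathrm{al}_{nest}(\sigma)$ is the number of $(i,j)\in[n]\times[n]$ satisfying at least one of: $-i<-j<-\sigma(j)<-\sigma(i)$; $\ -i<j\le\sigma(j)<-\sigma(i)$; $\ i<j\le\sigma(j)<\sigma(i)$. $\mathrm{al}_{EN}(\sigma)$ is the number of $(i,j)\in[n]\times[n]$ satisfying at least one of: $-i<0<-\sigma(i)<\sigma(j)<j$; $\ i\le\sigma(i)<\sigma(j)<j$. $\mathrm{al}_{NE}(\sigma)$ is the number of $(i,j)\in[n]\times[n]$ with $\sigma(i)<i<j\le\sigma(j)$. Diagrams. For $0\le k\le n$, a $(k,n)$-diagram is a left-justified diagram of boxes in a $k\times(n-k)$ rectangle with $\lambda_r$ boxes in row $r$, $\lambda_1\ge\dots\ge\lambda_k\ge0$. A shifted $(k,n)$-diagram is a $(k,n)$-diagram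 together with a staircase of boxes added above it, the $j$-th column from the left receiving $n-k-j+1$ additional boxes; the topmost box of each column is called a diagonal. Labels: follow the southeast border of the $(k,n)$-diagram from the northeast corner to the southwest corner of the rectangle, labeling its unit steps $1,\dots,n$; a vertical step gives its label to its row, a horizontal step gives its label to its column. Each added (staircase) row, whose diagonal (rightmost) box lies in the column labeled $i$, is labeled $-i$. Permutation tableau of type $B$ of length $n$ (set $\mathcal{PT}_n^B$): a $(0,1)$-filling of a shifted $(k,n)$-diagram such that (i) every column contains a $1$; (ii) a box with a $1$ above it in its column and a $1$ to its left in its row contains a $1$; (iii) if a diagonal contains $0$, its row contains no $1$. Zigzag paths and $\zeta$. The zigzag path from a row (column) starts at the left of that row (the top of that column) moving east (south), switches direction between east and south at each $1$ it meets, and stops when it reaches the right end of a row or the bottom of a column. $\zeta:\mathcal{PT}_n^B\to\mathfrak{S}_n^B$ is the map such that for $i\in[n]$: if $i$ labels a row, $\zeta(\mathcal{T})(i)$ is the label of the row or column where the path from row $i$ ends; if $-i$ labels a row with $0$ in its diagonal, $\zeta(\mathcal{T})(i)$ is the label where the path from column $i$ ends; if $-i$ labels a row with $1$ in its diagonal, $\zeta(\mathcal{T})(-i)$ is the label where the path from row $-i$ ends. Statistics. Through each box containing $0$ pass exactly two zigzag paths, one vertically and one horizontally. A $0$ is of type $EE$ if both paths are from rows of $\mathcal{T}$; of type $NN$ if both are from columns; of type $EN$ if it is not in a row with negative label filled entirely with $0$'s and one of the two paths is from a row and the other from a column. $\mathrm{zero}_{EE}(\mathcal{T})$, $\mathrm{zero}_{NN}(\mathcal{T})$,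 $\mathrm{zero}_{EN}(\mathcal{T})$ are the numbers of $0$'s of these types. $\mathrm{two}(\mathcal{T})$ is the number of boxes of the $k\times(n-k)$ rectangle lying outside the $(k,n)$-diagram contained in the shifted diagram of $\mathcal{T}$ (these boxes are filled with $2$'s in the extended representation). *)

theory Defs
  imports Main
begin

text \<open>
  Alignments of a signed permutation. A signed permutation of length \<open>n\<close> is represented by a
  function on \<open>int\<close>, of which only the values on \<open>[n]\<close> are used here.
\<close>

definition al_nest :: "nat \<Rightarrow> (int \<Rightarrow> int) \<Rightarrow> nat" where
  "al_nest n \<sigma> = card {(i, j). i \<in> {1..int n} \<and> j \<in> {1..int n} \<and>
     ((- i < - j \<and> - j < - \<sigma> j \<and> - \<sigma> j < - \<sigma> i) \<or>
      (- i < j \<and> j \<le> \<sigma> j \<and> \<sigma> j < - \<sigma> i) \<or>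
      (i < j \<and> j \<le> \<sigma> j \<and> \<sigma> j < \<sigma> i))}"

definition al_EN :: "nat \<Rightarrow> (int \<Rightarrow> int) \<Rightarrow> nat" where
  "al_EN n \<sigma> = card {(i, j). i \<in> {1..int n} \<and> j \<in> {1..int n} \<and>
     ((- i < 0 \<and> 0 < - \<sigma> i \<and> - \<sigma> i < \<sigma> j \<and> \<sigma> j < j) \<or>
      (i \<le> \<sigma> i \<and> \<sigma> i < \<sigma> j \<and> \<sigma> j < j))}"

definition al_NE :: "nat \<Rightarrow> (int \<Rightarrow> int) \<Rightarrow> nat" where
  "al_NE n \<sigma> = card {(i, j). i \<in> {1..int n} \<and> j \<in> {1..int n} \<and>
     \<sigma> i < i \<and> i < j \<and> j \<le> \<sigma> j}"

text \<open>
  A shifted \<open>(k,n)\<close>-diagram with a \<open>(0,1)\<close>-filling: \<open>parts\<close> lists the row lengths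
  \<open>\<lambda>\<^sub>1, \<dots>, \<lambda>\<^sub>k\<close> of the \<open>(k,n)\<close>-diagram (zero rows included), \<open>ncols\<close> is \<open>n - k\<close>, and \<open>ones\<close> is
  the set of boxes filled with \<open>1\<close>.

  Boxes are written \<open>(row, column)\<close> in matrix coordinates, rows counted from the top of the
  staircase, starting at \<open>1\<close>. Since column \<open>j\<close> has \<open>n - k - j + 1\<close> staircase boxes, there are
  \<open>n - k\<close> staircase rows, row \<open>i \<le> n - k\<close> consists of the columns \<open>1, \<dots>, i\<close>, and the topmost box
  (the diagonal) of column \<open>j\<close> is \<open>(j, j)\<close>. Row \<open>r\<close> of the \<open>(k,n)\<close>-diagram is row \<open>n - k + r\<close>, so
  that there are \<open>n\<close> rows in total.
\<close>

record filling =
  ncols :: nat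
  parts :: "nat list"
  ones :: "(nat \<times> nat) set"

definition len :: "filling \<Rightarrow> nat" where
  "len T = ncols T + length (parts T)"

definition row_len :: "filling \<Rightarrow> nat \<Rightarrow> nat" where
  "row_len T i = (if i \<le> ncols T then i else parts T ! (i - ncols T - 1))"

definition boxes :: "filling \<Rightarrow> (nat \<times> nat) set" where
  "boxes T = {(i, j). 1 \<le> i \<and> i \<le> len T \<and> 1 \<le> j \<and> j \<le> row_len T i}"

definition zeros :: "filling \<Rightarrow> (nat \<times> nat) set" where
  "zeros T = boxes T - ones T"

definition PTB :: "nat \<Rightarrow> filling set" where
  "PTB n = {T.
     len T = n \<and>
     sorted_wrt (\<ge>) (parts T) \<and> (\<forall>p \<in> set (parts T). p \<le> ncols T) \<and>
     ones T \<subseteq> boxes T \<and>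
     (\<forall>j \<in> {1..ncols T}. \<exists>i. (i, j) \<in> ones T) \<and>
     (\<forall>i j i' j'. (i, j) \<in> boxes T \<and> i' < i \<and> (i', j) \<in> ones T \<and> j' < j \<and> (i, j') \<in> ones T
        \<longrightarrow> (i, j) \<in> ones T) \<and>
     (\<forall>j \<in> {1..ncols T}. (j, j) \<notin> ones T \<longrightarrow> (\<forall>j'. (j, j') \<notin> ones T))}"

datatype line = Row nat | Col nat

text \<open>
  The label of a step of the southeast border is its position on the walk from the northeast to
  the southwest corner. The horizontal step below column \<open>j\<close> comes after those of the columns
  \<open>j + 1, \<dots>, n - k\<close> and after the vertical steps of the rows of length at least \<open>j\<close>. The vertical
  step of row \<open>r\<close> of the \<open>(k,n)\<close>-diagram comes after \<open>r - 1\<close> vertical and \<open>n - k - \<lambda>\<^sub>r\<close> horizontal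
  steps.
\<close>

definition col_label :: "filling \<Rightarrow> nat \<Rightarrow> nat" where
  "col_label T j = (ncols T - j) + length (filter (\<lambda>p. j \<le> p) (parts T)) + 1"

fun label :: "filling \<Rightarrow> line \<Rightarrow> int" where
  "label T (Col j) = int (col_label T j)"
| "label T (Row i) =
     (if i \<le> ncols T then - int (col_label T i)
      else int ((i - ncols T) + (ncols T - row_len T i)))"

datatype direction = East | South

fun switch :: "direction \<Rightarrow> direction" where
  "switch East = South"
| "switch South = East"

fun step :: "direction \<Rightarrow> nat \<times> nat \<Rightarrow> nat \<times> nat" where
  "step East (i, j) = (i, j + 1)"
| "step South (i, j) = (i + 1, j)"

text \<open>
  \<open>enters T s d b\<close>: the zigzag path starting from the line \<open>s\<close> arrives at position \<open>b\<close> moving in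
  direction \<open>d\<close>. The last position reached lies just outside the diagram, one step beyond the
  right end of a row or the bottom of a column.
\<close>

inductive enters :: "filling \<Rightarrow> line \<Rightarrow> direction \<Rightarrow> nat \<times> nat \<Rightarrow> bool" for T where
  from_row: "i \<in> {1..len T} \<Longrightarrow> enters T (Row i) East (i, 1)"
| from_col: "j \<in> {1..ncols T} \<Longrightarrow> enters T (Col j) South (j, j)"
| zero: "enters T s d b \<Longrightarrow> b \<in> boxes T \<Longrightarrow> b \<notin> ones T \<Longrightarrow> enters T s d (step d b)"
| one: "enters T s d b \<Longrightarrow> b \<in> boxes T \<Longrightarrow> b \<in> ones T \<Longrightarrow>
    enters T s (switch d) (step (switch d) b)"

inductive ends_at :: "filling \<Rightarrow> line \<Rightarrow> line \<Rightarrow> bool" for T where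
  "enters T s East (i, j) \<Longrightarrow> (i, j) \<notin> boxes T \<Longrightarrow> ends_at T s (Row i)"
| "enters T s South (i, j) \<Longrightarrow> (i, j) \<notin> boxes T \<Longrightarrow> ends_at T s (Col j)"

text \<open>
  The graph of the signed permutation \<open>\<zeta>(T)\<close>; the last rule is the extension by
  \<open>\<zeta>(T)(-x) = - \<zeta>(T)(x)\<close>.
\<close>

inductive zeta_graph :: "filling \<Rightarrow> int \<Rightarrow> int \<Rightarrow> bool" for T where
  positive_row:
    "i \<in> {ncols T <.. len T} \<Longrightarrow> ends_at T (Row i) e \<Longrightarrow>
     zeta_graph T (label T (Row i)) (label T e)"
| diagonal_zero:
    "j \<in> {1..ncols T} \<Longrightarrow> (j, j) \<notin> ones T \<Longrightarrow> ends_at T (Col j) e \<Longrightarrow>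
     zeta_graph T (label T (Col j)) (label T e)"
| diagonal_one:
    "j \<in> {1..ncols T} \<Longrightarrow> (j, j) \<in> ones T \<Longrightarrow> ends_at T (Row j) e \<Longrightarrow>
     zeta_graph T (label T (Row j)) (label T e)"
| sign: "zeta_graph T x y \<Longrightarrow> zeta_graph T (- x) (- y)"

text \<open>Outside \<open>[\<plusminus>n]\<close> the map is the identity.\<close>

definition zeta :: "filling \<Rightarrow> int \<Rightarrow> int" where
  "zeta T x = (if x \<noteq> 0 \<and> \<bar>x\<bar> \<le> int (len T) then THE y. zeta_graph T x y else x)"

text \<open>
  Both the horizontal and the vertical path through a box containing \<open>0\<close> keep their direction, so
  they are the paths entering it moving east and south, respectively.
\<close>

definition zero_EE :: "filling \<Rightarrow> nat" where
  "zero_EE T = card {b \<in> zeros T.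
     (\<exists>r. enters T (Row r) East b) \<and> (\<exists>r. enters T (Row r) South b)}"

definition zero_NN :: "filling \<Rightarrow> nat" where
  "zero_NN T = card {b \<in> zeros T.
     (\<exists>c. enters T (Col c) East b) \<and> (\<exists>c. enters T (Col c) South b)}"

definition zero_EN :: "filling \<Rightarrow> nat" where
  "zero_EN T = card {(i, j) \<in> zeros T.
     \<not> (label T (Row i) < 0 \<and> (\<forall>j'. (i, j') \<notin> ones T)) \<and>
     ((\<exists>r c. enters T (Row r) East (i, j) \<and> enters T (Col c) South (i, j)) \<or>
      (\<exists>r c. enters T (Col c) East (i, j) \<and> enters T (Row r) South (i, j)))}"

definition two :: "filling \<Rightarrow> nat" where
  "two T = card ({ncols T <.. len T} \<times> {1..ncols T} - boxes T)"

end

theory Submission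
  imports Defs
begin

text \<open>
  The idea is to watch the southeast border of the region of boxes processed so far, while the boxes
  are added one at a time, row by row and from left to right. Reading the border from southwest to
  northeast and recording for each unit step the path that crosses it gives a word of starting
  lines. Adding a box replaces its left and top side, which are consecutive steps of the border, by
  its bottom and right side. The two paths through the box turn at a \<open>1\<close>, so the word does not change;
  they go straight at a \<open>0\<close>, so two neighbouring letters are swapped.

  Rank the starting lines as they lie on the northwest border: lower rows come first, then higher
  rows, then the columns from left to right. At a \<open>0\<close> the path moving east always has smaller rank
  than the path moving south (\<open>zero_rank_less\<close>): condition (ii) on the filling means that a \<open>0\<close> has no \<open>1\<close> to
  its left or no \<open>1\<close> above it, so one of the two paths has come straight from its line. Each \<open>0\<close> thus
  creates exactly one inversion of the word, and none is ever removed. The staircase rows with \<open>0\<close> on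
  the diagonal are excepted: they contain no \<open>1\<close>, their own paths are left out of the word, and passing
  them does not permute the other paths. So for every relation \<open>Q\<close>
  between lines, the zeros outside such rows whose two paths are related by \<open>Q\<close> are equinumerous to the inversions
  related by \<open>Q\<close> of the final word (\<open>pass_row\<close>, \<open>word_invariant\<close>, \<open>card_crossings\<close>). This is why the
  types \<open>EE\<close>, \<open>NN\<close> and \<open>EN\<close> can all be treated at once.

  The final word lists the paths by decreasing label of their ends, so its inversions are the pairs
  of paths whose ends are ordered differently from their starts. The paths in the word are those which
  define \<open>\<zeta>(T)\<close>: one for each \<open>x\<close> in \<open>[n]\<close>, from a row if \<open>x\<close> labels a row, from a staircase row
  if \<open>\<zeta>(T)(x) < 0\<close>, and from a column otherwise. In the last case the image of \<open>x\<close> is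
  smaller than \<open>x\<close>, in the first case it is at least \<open>x\<close> (\<open>col_anti_excedance\<close>,
  \<open>row_weak_excedance\<close>). With this, the inequalities that define the alignments say that two paths
  of given kinds form an inversion, with one exception: a nesting \<open>(i, j)\<close> with \<open>\<zeta>(T)(i) < 0 < \<zeta>(T)(j) < j < i\<close>
  corresponds to a zero of a row with \<open>0\<close> on its diagonal, which is the path of the whole row
  crossing the path of a higher row (\<open>card_blank_row_crossings\<close>).

  The third statistic needs only that \<open>\<zeta>(T)(x) < x\<close> holds precisely for the column labels \<open>x\<close>, and
  that a column has a smaller label than a row of the rectangle iff they meet outside the diagram.
\<close>

section \<open>Counting pairs in a list\<close>

text \<open>
  With the relation ``has larger rank than'' this is the number of inversions of a list.
\<close>

fun pair_count :: "('a \<Rightarrow> 'a \<Rightarrow> bool) \<Rightarrow> 'a list \<Rightarrow> nat" where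
  "pair_count P [] = 0"
| "pair_count P (x # xs) = length (filter (P x) xs) + pair_count P xs"

lemma pair_count_swap:
  assumes "\<not> P a b"
  shows "pair_count P (xs @ b # a # ys) = pair_count P (xs @ a # b # ys) + (if P b a then 1 else 0)"
  using assms by (induction xs) auto

lemma pair_count_snoc:
  "pair_count P (xs @ [x]) = pair_count P xs + length (filter (\<lambda>y. P y x) xs)"
  by (induction xs) auto

text \<open>
  A list sorted by \<open>G\<close> turns counting by position into counting by \<open>G\<close>. Here \<open>G\<close> will be the order of
  the labels along the border, and \<open>f\<close> sends the end of a path to its start.
\<close>

lemma pair_count_sorted:
  assumes "sorted_wrt G xs" "\<And>x y. G x y \<Longrightarrow> \<not> G y x" "distinct xs"
  shows "pair_count P (map f xs) = card {(x, y) \<in> set xs \<times> set xs. G x y \<and> P (f x) (f y)}"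
  using assms
proof (induction xs)
  case (Cons a xs)
  let ?N = "{(x, y) \<in> set xs \<times> set xs. G x y \<and> P (f x) (f y)}"
  have G: "\<not> G x a" if "x \<in> set xs" for x using Cons.prems that by auto
  have Ga: "\<not> G a a" using Cons.prems(2) by blast
  have "{(x, y) \<in> set (a # xs) \<times> set (a # xs). G x y \<and> P (f x) (f y)} =
      Pair a ` {y \<in> set xs. P (f a) (f y)} \<union> ?N"
    using Cons.prems(1) G Ga by auto
  moreover have "Pair a ` {y \<in> set xs. P (f a) (f y)} \<inter> ?N = {}"
    using Cons.prems(3) by auto
  moreover have "finite ?N" by (rule finite_subset[of _ "set xs \<times> set xs"]) auto
  ultimately have "card {(x, y) \<in> set (a # xs) \<times> set (a # xs). G x y \<and> P (f x) (f y)} =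
      card (Pair a ` {y \<in> set xs. P (f a) (f y)}) + card ?N"
    by (simp add: card_Un_disjoint)
  also have "card (Pair a ` {y \<in> set xs. P (f a) (f y)}) = card {y \<in> set xs. P (f a) (f y)}"
    by (rule card_image) (simp add: inj_on_def)
  also have "\<dots> = length (filter (P (f a)) (map f xs))"
    using Cons.prems(3) by (simp add: filter_map o_def distinct_card[symmetric])
  finally show ?case using Cons by simp
qed simp

lemma card_pairs_bij:
  assumes "bij_betw f A B"
  shows "card {(x, y) \<in> B \<times> B. P x y} = card {(x, y) \<in> A \<times> A. P (f x) (f y)}"
proof -
  have "bij_betw (map_prod f f) {(x, y) \<in> A \<times> A. P (f x) (f y)} {(x, y) \<in> B \<times> B. P x y}"
    unfolding bij_betw_def
  proof
    show "inj_on (map_prod f f) {(x, y) \<in> A \<times> A. P (f x) (f y)}"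
      using assms by (auto simp: bij_betw_def inj_on_def)
    show "map_prod f f ` {(x, y) \<in> A \<times> A. P (f x) (f y)} = {(x, y) \<in> B \<times> B. P x y}"
      using assms by (fastforce simp: bij_betw_def image_iff)
  qed
  then show ?thesis by (simp add: bij_betw_same_card)
qed

lemma pairs_cong:
  assumes "\<And>x y. x \<in> A \<Longrightarrow> y \<in> A \<Longrightarrow> P x y \<longleftrightarrow> Q x y"
  shows "{(x, y) \<in> A \<times> A. P x y} = {(x, y) \<in> A \<times> A. Q x y}"
  using assms by auto

lemma card_pairs_swap: "card {(x, y) \<in> A \<times> A. P y x} = card {(x, y) \<in> A \<times> A. P x y}"
proof -
  have "{(x, y) \<in> A \<times> A. P y x} = prod.swap ` {(x, y) \<in> A \<times> A. P x y}" by force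
  then show ?thesis by (simp add: card_image inj_on_def)
qed

lemma card_pairs_disj:
  assumes "finite A" "\<And>x y. P x y \<Longrightarrow> \<not> Q x y"
  shows "card {(x, y) \<in> A \<times> A. P x y \<or> Q x y} =
    card {(x, y) \<in> A \<times> A. P x y} + card {(x, y) \<in> A \<times> A. Q x y}"
proof -
  have fin: "finite {(x, y) \<in> A \<times> A. R x y}" for R
    by (rule finite_subset[of _ "A \<times> A"]) (use assms(1) in auto)
  have un: "{(x, y) \<in> A \<times> A. P x y \<or> Q x y} = {(x, y) \<in> A \<times> A. P x y} \<union> {(x, y) \<in> A \<times> A. Q x y}"
    by auto
  have "{(x, y) \<in> A \<times> A. P x y} \<inter> {(x, y) \<in> A \<times> A. Q x y} = {}"
    using assms(2) by auto
  then show ?thesis unfolding un by (rule card_Un_disjoint[OF fin fin])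
qed

text \<open>The parts of size at least \<open>j\<close> form a prefix, the conjugate partition gives its length.\<close>

lemma nth_ge_iff_less_length_filter:
  fixes ps :: "nat list"
  assumes "sorted_wrt (\<ge>) ps" "q < length ps"
  shows "j \<le> ps ! q \<longleftrightarrow> q < length (filter (\<lambda>p. j \<le> p) ps)"
  using assms
proof (induction ps arbitrary: q)
  case (Cons p ps)
  show ?case
  proof (cases "j \<le> p")
    case True
    then show ?thesis using Cons by (cases q) auto
  next
    case False
    then have "filter (\<lambda>p. j \<le> p) ps = []" using Cons.prems by (auto simp: filter_empty_conv)
    moreover have "(p # ps) ! q \<le> p" using Cons.prems by (cases q) auto
    ultimately show ?thesis using False by auto
  qed
qed simp

section \<open>The path through a given position\<close>

text \<open>
  Zigzag paths can be followed backwards: the path entering a position is determined by the box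
  before it. The recursion yields its starting line for all pairs of natural numbers. Since boxes
  outside the diagram contain no \<open>1\<close>, a path that has left the diagram simply goes straight on, so its
  start may be read off at any later position of the same row or column.
\<close>

fun east :: "filling \<Rightarrow> nat \<Rightarrow> nat \<Rightarrow> line" and south :: "filling \<Rightarrow> nat \<Rightarrow> nat \<Rightarrow> line" where
  "east T i 0 = Row i"
| "east T i (Suc j) = (if (i, j) \<in> ones T then south T i j else east T i j)"
| "south T 0 j = Col j"
| "south T (Suc i) j = (if (i, j) \<in> ones T then east T i j else south T i j)"

text \<open>
  The order in which the starting lines occur on the northwest border, from southwest to northeast.
\<close>

fun rank :: "line \<Rightarrow> int" where
  "rank (Row i) = - int i"
| "rank (Col j) = int j"

fun is_row :: "line \<Rightarrow> bool" where
  "is_row (Row i) = True"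
| "is_row (Col j) = False"

locale tableau =
  fixes n :: nat and T :: filling
  assumes PTB: "T \<in> PTB n"
begin

abbreviation "m \<equiv> ncols T"
abbreviation "w \<equiv> row_len T"

lemma len_T [simp]: "len T = n" and m_le: "m \<le> n"
  and parts_sorted: "sorted_wrt (\<ge>) (parts T)"
  and parts_le: "p \<in> set (parts T) \<Longrightarrow> p \<le> m"
  and ones_boxes: "ones T \<subseteq> boxes T"
  and column_one: "1 \<le> j \<Longrightarrow> j \<le> m \<Longrightarrow> \<exists>i. (i, j) \<in> ones T"
  and forced_one: "(i, j) \<in> boxes T \<Longrightarrow> i' < i \<Longrightarrow> (i', j) \<in> ones T \<Longrightarrow> j' < j \<Longrightarrow> (i, j') \<in> ones T
    \<Longrightarrow> (i, j) \<in> ones T"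
  and blank_row: "1 \<le> j \<Longrightarrow> j \<le> m \<Longrightarrow> (j, j) \<notin> ones T \<Longrightarrow> (j, j') \<notin> ones T"
proof -
  show "sorted_wrt (\<ge>) (parts T)" "p \<in> set (parts T) \<Longrightarrow> p \<le> m"
    using PTB unfolding PTB_def by blast+
  have *: "len T = n" "ones T \<subseteq> boxes T" "\<forall>j \<in> {1..m}. \<exists>i. (i, j) \<in> ones T"
    "\<forall>i j i' j'. (i, j) \<in> boxes T \<and> i' < i \<and> (i', j) \<in> ones T \<and> j' < j \<and> (i, j') \<in> ones T
       \<longrightarrow> (i, j) \<in> ones T"
    "\<forall>j \<in> {1..m}. (j, j) \<notin> ones T \<longrightarrow> (\<forall>j'. (j, j') \<notin> ones T)"
    using PTB unfolding PTB_def mem_Collect_eq by - ((elim conjE, assumption)+)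
  show "len T = n" "m \<le> n" using *(1) by (simp_all add: len_def)
  show "ones T \<subseteq> boxes T" by (fact *(2))
  show "1 \<le> j \<Longrightarrow> j \<le> m \<Longrightarrow> \<exists>i. (i, j) \<in> ones T" using *(3) by simp
  show "(i, j) \<in> boxes T \<Longrightarrow> i' < i \<Longrightarrow> (i', j) \<in> ones T \<Longrightarrow> j' < j \<Longrightarrow> (i, j') \<in> ones T
    \<Longrightarrow> (i, j) \<in> ones T" using *(4) by blast
  show "1 \<le> j \<Longrightarrow> j \<le> m \<Longrightarrow> (j, j) \<notin> ones T \<Longrightarrow> (j, j') \<notin> ones T" using *(5) by (metis atLeastAtMost_iff)
qed

lemma row_len_staircase: "i \<le> m \<Longrightarrow> w i = i" by (simp add: row_len_def)

lemma row_len_le: "i \<le> n \<Longrightarrow> w i \<le> m"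
  using parts_le len_T by (auto simp: row_len_def len_def simp del: len_T)

lemma row_len_antimono:
  assumes "m \<le> i" "i \<le> i'" "i' \<le> n"
  shows "w i' \<le> w i"
proof (cases "i = m \<or> i = i'")
  case True
  then show ?thesis using row_len_le[OF assms(3)] row_len_staircase[of m] by auto
next
  case False
  then have "i - m - 1 < i' - m - 1" "i' - m - 1 < length (parts T)"
    using assms len_T by (auto simp: len_def simp del: len_T)
  then have "parts T ! (i - m - 1) \<ge> parts T ! (i' - m - 1)"
    using sorted_wrt_nth_less[OF parts_sorted] by simp
  then show ?thesis using assms False by (auto simp: row_len_def)
qed

lemma mem_boxes: "(i, j) \<in> boxes T \<longleftrightarrow> 1 \<le> i \<and> i \<le> n \<and> 1 \<le> j \<and> j \<le> w i"
  by (auto simp: boxes_def)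

lemma onesD: "(i, j) \<in> ones T \<Longrightarrow> 1 \<le> i \<and> i \<le> n \<and> 1 \<le> j \<and> j \<le> w i"
  using ones_boxes mem_boxes by blast

lemma no_zero_index [simp]: "(0, j) \<notin> ones T" "(i, 0) \<notin> ones T"
  using onesD by force+

lemma finite_zeros: "finite (zeros T)"
proof (rule finite_subset)
  show "zeros T \<subseteq> {1..n} \<times> {1..m}"
    using row_len_le by (force simp: zeros_def mem_boxes)
qed simp

abbreviation "E \<equiv> east T"
abbreviation "S \<equiv> south T"

lemma east_south_range:
  shows "E i j = Row r \<Longrightarrow> r \<le> i" "E i j = Col c \<Longrightarrow> c < j"
    "S i j = Row r \<Longrightarrow> r < i" "S i j = Col c \<Longrightarrow> c \<le> j"
proof -
  have "(case east U i j of Row r \<Rightarrow> r \<le> i | Col c \<Rightarrow> c < j)"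
    "(case south U i j of Row r \<Rightarrow> r < i | Col c \<Rightarrow> c \<le> j)" for U
    by (induction U i j and U i j rule: east_south.induct) (auto split: line.splits)
  from this[of T] show "E i j = Row r \<Longrightarrow> r \<le> i" "E i j = Col c \<Longrightarrow> c < j"
    "S i j = Row r \<Longrightarrow> r < i" "S i j = Col c \<Longrightarrow> c \<le> j"
    by (auto split: line.splits)
qed

lemma east_const:
  assumes "j \<le> j'" "\<And>c. j \<le> c \<Longrightarrow> c < j' \<Longrightarrow> (i, c) \<notin> ones T"
  shows "E i j' = E i j"
  using assms by (induction j' rule: dec_induct) auto

lemma south_const:
  assumes "i \<le> i'" "\<And>r. i \<le> r \<Longrightarrow> r < i' \<Longrightarrow> (r, j) \<notin> ones T"
  shows "S i' j = S i j"
  using assms by (induction i' rule: dec_induct) auto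

lemma east_no_one: "(\<And>c. c < j \<Longrightarrow> (i, c) \<notin> ones T) \<Longrightarrow> E i j = Row i"
  using east_const[of 0 j i] by simp

lemma south_no_one: "(\<And>r. r < i \<Longrightarrow> (r, j) \<notin> ones T) \<Longrightarrow> S i j = Col j"
  using south_const[of 0 i j] by simp

lemma south_eq_ColD: "S i j = Col j \<Longrightarrow> r < i \<Longrightarrow> (r, j) \<notin> ones T"
proof (induction i)
  case (Suc i)
  then have "(i, j) \<notin> ones T" using east_south_range(2)[of i j j] by auto
  then show ?case using Suc by (auto simp: less_Suc_eq)
qed simp

lemma south_row: "S i j = Row r \<Longrightarrow> \<exists>r'\<ge>r. (r', j) \<in> ones T"
proof (induction i)
  case (Suc i)
  then show ?case using east_south_range(1)[of i j r] by (auto split: if_splits)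
qed simp

lemma east_col: "E i j = Col c \<Longrightarrow> \<exists>c'\<ge>c. (i, c') \<in> ones T"
proof (induction j)
  case (Suc j)
  then show ?case using east_south_range(4)[of i j c] by (auto split: if_splits)
qed simp

lemma south_diag: 
  assumes "i \<le> j" "1 \<le> j" "j \<le> m" shows "S i j = Col j"
proof (rule south_no_one)
  fix r assume "r < i"
  then show "(r, j) \<notin> ones T" using onesD[of r j] assms row_len_staircase[of r] by auto
qed

text \<open>
  This is where condition (ii) enters. If a \<open>1\<close> lies to the left of the \<open>0\<close> then none lies above it, so
  the path moving south comes from the top of column \<open>j\<close>, and the other path can only come from a
  column further left or from a row. Otherwise the path moving east comes from row \<open>i\<close>, and the
  other path from a higher row or from a column.
\<close>

lemma zero_rank_less:
  assumes "(i, j) \<in> boxes T" "(i, j) \<notin> ones T"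
  shows "rank (E i j) < rank (S i j)"
proof (cases "\<exists>c<j. (i, c) \<in> ones T")
  case True
  then have "S i j = Col j" using assms forced_one[of i j] by (intro south_no_one) blast
  moreover have "j \<ge> 1" using assms by (simp add: mem_boxes)
  ultimately show ?thesis using east_south_range[of i j] by (cases "E i j") force+
next
  case False
  then have "E i j = Row i" by (intro east_no_one) blast
  moreover have "i \<ge> 1" using assms by (simp add: mem_boxes)
  ultimately show ?thesis using east_south_range[of i j] by (cases "S i j") force+
qed

lemma enters_imp_path:
  shows "enters T s d b \<Longrightarrow> (case d of 
     East \<Rightarrow> s = E (fst b) (snd b) \<and> 1 \<le> fst b \<and> fst b \<le> n \<and> 1 \<le> snd b \<and> snd b \<le> Suc (w (fst b))
   | South \<Rightarrow> s = S (fst b) (snd b) \<and> 1 \<le> snd b \<and> snd b \<le> m \<and> snd b \<le> fst b \<and>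
       fst b \<le> Suc n)"
proof (induction rule: enters.induct)
  case (from_row i)
  then show ?case using east_no_one[of 1 i] by auto
next
  case (from_col j)
  then show ?case using south_diag[of j j] m_le by auto
next
  case (zero s d b)
  then show ?case by (cases b; cases d) (auto simp: mem_boxes)
next
  case (one s d b)
  have "snd b \<le> m" using one row_len_le[of "fst b"] by (cases b) (auto simp: mem_boxes)
  moreover from this have "snd b \<le> fst b"
    using one row_len_staircase[of "fst b"] by (cases b; cases "fst b \<le> m") (auto simp: mem_boxes)
  ultimately show ?case using one by (cases b; cases d) (auto simp: mem_boxes)
qed

lemma enters_path:
  shows "1 \<le> i \<Longrightarrow> i \<le> n \<Longrightarrow> 1 \<le> j \<Longrightarrow> j \<le> Suc (w i) \<Longrightarrow> enters T (E i j) East (i, j)"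
    "1 \<le> j \<Longrightarrow> j \<le> m \<Longrightarrow> j \<le> i \<Longrightarrow> i = j \<or> (i - 1, j) \<in> boxes T \<Longrightarrow> enters T (S i j) South (i, j)"
proof (induction "i + j" arbitrary: i j rule: less_induct)
  case less
  {
    case 1
    show ?case
    proof (cases "j = 1")
      case True
      then show ?thesis using 1 enters.from_row[of i T] by simp
    next
      case False
      then obtain c where c: "j = Suc c" "1 \<le> c" using 1 by (cases j) auto
      have b: "(i, c) \<in> boxes T" using 1 c by (simp add: mem_boxes)
      show ?thesis
      proof (cases "(i, c) \<in> ones T")
        case True
        have "c \<le> i" "i = c \<or> (i - 1, c) \<in> boxes T" "c \<le> m"
          using 1 c row_len_staircase[of i] row_len_le[of i] row_len_antimono[of "i - 1" i]
            row_len_staircase[of "i - 1"]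
          by (cases "i \<le> m"; force simp: mem_boxes)+
        then have "enters T (S i c) South (i, c)" using less(2)[of i c] c by simp
        from enters.one[OF this b True] show ?thesis using True c by simp
      next
        case False
        have "enters T (E i c) East (i, c)" using less(1)[of i c] 1 c by simp
        from enters.zero[OF this b False] show ?thesis using False c by simp
      qed
    qed
  next
    case 2
    show ?case
    proof (cases "i = j")
      case True
      then show ?thesis using 2 south_diag[of j j] enters.from_col[of j T] by simp
    next
      case False
      then obtain r where r: "i = Suc r" "j \<le> r" using 2 by (cases i) auto
      have b: "(r, j) \<in> boxes T" using 2 r False by simp
      show ?thesis
      proof (cases "(r, j) \<in> ones T")
        case True
        have "enters T (E r j) East (r, j)" using less(1)[of r j] r b by (simp add: mem_boxes)
        from enters.one[OF this b True] show ?thesis using True r by simp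
      next
        case False
        have "r = j \<or> (r - 1, j) \<in> boxes T"
          using 2 r b row_len_staircase[of "r - 1"] row_len_antimono[of "r - 1" r]
          by (cases "r \<le> m"; force simp: mem_boxes)
        then have "enters T (S r j) South (r, j)" using less(2)[of r j] 2 r by simp
        from enters.zero[OF this b False] show ?thesis using False r by simp
      qed
    qed
  }
qed

lemma enters_box_iff:
  assumes "(i, j) \<in> boxes T"
  shows "enters T s East (i, j) \<longleftrightarrow> s = E i j" "enters T s South (i, j) \<longleftrightarrow> s = S i j"
proof -
  have *: "1 \<le> i" "i \<le> n" "1 \<le> j" "j \<le> w i" using assms by (auto simp: mem_boxes)
  show "enters T s East (i, j) \<longleftrightarrow> s = E i j"
    using enters_imp_path[of s East "(i, j)"] enters_path(1)[of i j] * by auto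
  have "j \<le> i" "i = j \<or> (i - 1, j) \<in> boxes T" "j \<le> m"
    using * row_len_staircase[of i] row_len_le[of i] row_len_antimono[of "i - 1" i]
      row_len_staircase[of "i - 1"]
    by (cases "i \<le> m"; force simp: mem_boxes)+
  then show "enters T s South (i, j) \<longleftrightarrow> s = S i j"
    using enters_imp_path[of s South "(i, j)"] enters_path(2)[of j i] * by auto
qed

section \<open>Order along the border\<close>

abbreviation "lab l \<equiv> label T l"

definition border :: "line set" where
  "border = Row ` {m<..n} \<union> Col ` {1..m}"

lemma finite_border [simp]: "finite border" by (simp add: border_def)

lemma card_border: "card border = n"
proof -
  have "card (Row ` {m<..n} \<union> Col ` {1..m}) = card (Row ` {m<..n}) + card (Col ` {1..m})"
    by (rule card_Un_disjoint) auto
  also have "\<dots> = n"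
    using m_le by (simp add: card_image inj_on_def)
  finally show ?thesis by (simp add: border_def)
qed

text \<open>
  The number of parts of size at least \<open>j\<close> also occurs in the label of column \<open>j\<close>, which makes
  labels of rows and columns comparable.
\<close>

lemma row_len_ge_iff:
  assumes "m < r" "r \<le> n"
  shows "j \<le> w r \<longleftrightarrow> r - m \<le> length (filter (\<lambda>p. j \<le> p) (parts T))"
proof -
  have "r - m - 1 < length (parts T)" using assms len_T by (auto simp: len_def simp del: len_T)
  from nth_ge_iff_less_length_filter[OF parts_sorted this, of j] show ?thesis
    using assms by (auto simp: row_len_def)
qed

lemma lab_Col_less_iff:
  assumes "1 \<le> j" "j \<le> m" "1 \<le> j'" "j' \<le> m"
  shows "lab (Col j) < lab (Col j') \<longleftrightarrow> j' < j"
proof -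
  have "length (filter (\<lambda>p. b \<le> p) ps) \<le> length (filter (\<lambda>p. a \<le> p) ps)"
    if "a \<le> b" for a b and ps :: "nat list"
    using that by (induction ps) auto
  note mono = this[of _ _ "parts T"]
  have "a < b \<Longrightarrow> b \<le> m \<Longrightarrow> lab (Col b) < lab (Col a)" for a b
    using mono[of a b] by (simp add: col_label_def)
  from this[of j j'] this[of j' j] show ?thesis using assms by (cases j j' rule: linorder_cases) auto
qed

lemma lab_Row_less_iff:
  assumes "m < r" "r \<le> n" "m < r'" "r' \<le> n"
  shows "lab (Row r) < lab (Row r') \<longleftrightarrow> r < r'"
proof -
  have "a < b \<Longrightarrow> m < a \<Longrightarrow> b \<le> n \<Longrightarrow> lab (Row a) < lab (Row b)" for a b
    using row_len_antimono[of a b] by auto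
  from this[of r r'] this[of r' r] show ?thesis using assms by (cases r r' rule: linorder_cases) auto
qed

lemma lab_Row_less_Col_iff:
  assumes "m < r" "r \<le> n" "1 \<le> j" "j \<le> m"
  shows "lab (Row r) < lab (Col j) \<longleftrightarrow> j \<le> w r" "lab (Col j) < lab (Row r) \<longleftrightarrow> w r < j"
proof -
  have "j \<le> w r \<Longrightarrow> lab (Row r) < lab (Col j)"
    using row_len_ge_iff[of r j] assms row_len_le[of r] by (auto simp: col_label_def)
  moreover have "w r < j \<Longrightarrow> lab (Col j) < lab (Row r)"
    using row_len_ge_iff[of r j] assms row_len_le[of r] by (auto simp: col_label_def)
  ultimately show "lab (Row r) < lab (Col j) \<longleftrightarrow> j \<le> w r" "lab (Col j) < lab (Row r) \<longleftrightarrow> w r < j"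
    by fastforce+
qed

lemmas lab_less_iffs = lab_Col_less_iff lab_Row_less_iff lab_Row_less_Col_iff

lemma inj_lab: "inj_on lab border"
proof (rule inj_onI)
  fix l l' assume *: "l \<in> border" "l' \<in> border" "lab l = lab l'"
  from *(1,2) have "l = l' \<or> lab l < lab l' \<or> lab l' < lab l" unfolding border_def
    by (elim UnE imageE; hypsubst) (simp_all add: lab_less_iffs del: label.simps; linarith)+
  then show "l = l'" using *(3) by simp
qed

lemma bij_lab: "bij_betw lab border {1..int n}"
proof -
  have "lab l \<in> {1..int n}" if "l \<in> border" for l
  proof -
    have "col_label T j \<le> n" if "1 \<le> j" "j \<le> m" for j
      using that len_T length_filter_le[of "\<lambda>p. j \<le> p" "parts T"]
      by (simp add: col_label_def len_def del: len_T length_filter_le)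
    then show ?thesis using that row_len_le unfolding border_def
      by (fastforce simp: col_label_def)
  qed
  then have "lab ` border \<subseteq> {1..int n}" by blast
  moreover have "card (lab ` border) = card {1..int n}"
    using inj_lab by (simp add: card_image card_border)
  ultimately have "lab ` border = {1..int n}" by (intro card_subset_eq) auto
  then show ?thesis using inj_lab by (simp add: bij_betw_def)
qed

text \<open>
  The start of the path ending at a given line of the border, read off beyond the right end of the row
  or the bottom of the column. Column \<open>m + 1\<close> and row \<open>n + 1\<close> lie beyond the diagram for every shape.
\<close>

definition path_start :: "line \<Rightarrow> line" where
  "path_start e = (case e of Row i \<Rightarrow> E i (Suc m) | Col j \<Rightarrow> S (Suc n) j)"

text \<open>
  The steps of the southeast border, from southwest to northeast, that rows after row \<open>i\<close> leave alone.
  For \<open>i > m\<close> the current border consists of the bottoms of the columns \<open>1, \<dots>, \<lambda>\<^sub>i\<close> followed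
  by these steps. Staircase rows contribute nothing: the path leaving such a row on the right
  takes no part in the permutation.
\<close>

fun finished :: "nat \<Rightarrow> line list" where
  "finished 0 = []"
| "finished (Suc i) =
     (if i < m then [] else Row (Suc i) # map Col [Suc (w (Suc i))..<Suc (w i)] @ finished i)"

definition cut :: "nat \<Rightarrow> line list" where
  "cut i = map Col [1..<Suc (w i)] @ finished i"

text \<open>The starts of the paths crossing the border that is cut off below row \<open>i\<close>.\<close>

definition word :: "nat \<Rightarrow> line list" where
  "word i = map (S (Suc i)) [1..<Suc (w i)] @ map path_start (finished i)"

lemma finished_staircase: "i \<le> m \<Longrightarrow> finished i = []"
  by (cases i) auto

lemma upt_split: "a \<le> b \<Longrightarrow> b \<le> c \<Longrightarrow> [a..<c] = [a..<b] @ [b..<c]"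
  by (metis le_Suc_ex upt_add_eq_append)

text \<open>
  Going one row down inserts the label of the new row between the columns that meet the row and those
  that do not, and does not change the order of the others.
\<close>

lemma cut_set_sorted:
  assumes "m \<le> i" "i \<le> n"
  shows "set (cut i) = Row ` {m<..i} \<union> Col ` {1..m} \<and> sorted_wrt (\<lambda>e e'. lab e' < lab e) (cut i)"
  using assms
proof (induction i rule: dec_induct)
  case base
  have "sorted_wrt (\<lambda>a b. lab (Col b) < lab (Col a)) [1..<Suc m]"
  proof (rule sorted_wrt_mono_rel[of _ "(<)"])
    fix a b assume "a \<in> set [1..<Suc m]" "b \<in> set [1..<Suc m]" "a < b"
    then show "lab (Col b) < lab (Col a)" using lab_Col_less_iff[of b a] by auto
  qed (simp del: upt_Suc)
  then show ?case
    by (auto simp: cut_def finished_staircase row_len_staircase sorted_wrt_map 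
        simp del: label.simps upt_Suc)
next
  case (step i)
  let ?X = "map Col [1..<Suc (w (Suc i))]" and ?Y = "map Col [Suc (w (Suc i))..<Suc (w i)] @ finished i"
  have le: "w (Suc i) \<le> w i" using row_len_antimono[of i "Suc i"] step by simp
  have c: "cut i = ?X @ ?Y"
    using upt_split[of 1 "Suc (w (Suc i))" "Suc (w i)"] le by (simp add: cut_def del: upt_Suc)
  have c': "cut (Suc i) = ?X @ Row (Suc i) # ?Y" using step by (simp add: cut_def del: upt_Suc)
  have IH: "set (?X @ ?Y) = Row ` {m<..i} \<union> Col ` {1..m}"
    "sorted_wrt (\<lambda>e e'. lab e' < lab e) (?X @ ?Y)" using step c by auto
  have wm: "w (Suc i) \<le> m" using row_len_le step by simp
  have X: "lab (Row (Suc i)) < lab x" if x: "x \<in> set ?X" for x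
  proof -
    obtain j where "x = Col j" "1 \<le> j" "j \<le> w (Suc i)" using x by auto
    then show ?thesis using lab_less_iffs(3)[of "Suc i" j] step wm by (simp del: label.simps)
  qed
  have Y: "lab y < lab (Row (Suc i))" if y: "y \<in> set ?Y" for y
  proof -
    have "distinct (?X @ ?Y)" using IH(2) 
      by (metis (mono_tags, lifting) distinct_conv_nth less_irrefl linorder_neqE_nat sorted_wrt_iff_nth_less)
    then have "y \<notin> set ?X" using y by (auto simp del: upt_Suc)
    moreover have "y \<in> Row ` {m<..i} \<union> Col ` {1..m}" using IH(1) y by (metis Un_iff set_append)
    ultimately show ?thesis using step
      by (auto simp: lab_less_iffs simp del: label.simps)
  qed
  have "set (cut (Suc i)) = insert (Row (Suc i)) (Row ` {m<..i} \<union> Col ` {1..m})"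
    unfolding c' IH(1)[symmetric] by auto
  also have "\<dots> = Row ` {m<..Suc i} \<union> Col ` {1..m}" using step 
    by (auto simp: image_iff le_Suc_eq)
  finally show ?case using IH(2) X Y lab_less_iffs unfolding c'
    by (auto simp: sorted_wrt_append simp del: label.simps upt_Suc)
qed

lemma map_path_start_cut: "map path_start (cut n) = word n"
  by (simp add: cut_def word_def path_start_def del: upt_Suc)

lemma path_start_Row:
  assumes "i \<le> n" shows "path_start (Row i) = E i (Suc (w i))"
  unfolding path_start_def line.case using assms row_len_le[of i]
  by (intro east_const) (auto dest: onesD)

lemma path_start_Col:
  assumes "m < i" "i \<le> Suc n" "i = Suc n \<or> w i < j"
  shows "path_start (Col j) = S i j"
  unfolding path_start_def line.case
proof (intro south_const)
  fix r assume "i \<le> r" "r < Suc n"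
  then show "(r, j) \<notin> ones T" using assms row_len_antimono[of i r] by (auto dest: onesD)
qed (use assms in simp)

section \<open>Passing a row\<close>

text \<open>
  The relation \<open>Q\<close> will select the kinds of the two paths.
\<close>

definition inverted :: "(line \<Rightarrow> line \<Rightarrow> bool) \<Rightarrow> line \<Rightarrow> line \<Rightarrow> bool" where
  "inverted Q s s' \<longleftrightarrow> rank s' < rank s \<and> Q s s'"

text \<open>
  The first \<open>l\<close> boxes of row \<open>r\<close> act on the word: before them stands the path entering row \<open>r\<close>, followed
  by the paths coming down the columns; \<open>Z\<close> stands for the steps that the boxes do not touch. The induction
  adds one box, which swaps two neighbours exactly when it contains a \<open>0\<close>.
\<close>

lemma pass_row:
  assumes "1 \<le> r" "r \<le> n" "l \<le> w r"
  shows "pair_count (inverted Q) (map (S (Suc r)) [1..<Suc l] @ E r (Suc l) # Z) =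
      pair_count (inverted Q) (Row r # map (S r) [1..<Suc l] @ Z) +
        card {j \<in> {1..l}. (r, j) \<notin> ones T \<and> Q (S r j) (E r j)} \<and>
    set (map (S (Suc r)) [1..<Suc l] @ E r (Suc l) # Z) = set (Row r # map (S r) [1..<Suc l] @ Z) \<and>
    (distinct (map (S (Suc r)) [1..<Suc l] @ E r (Suc l) # Z) \<longleftrightarrow>
      distinct (Row r # map (S r) [1..<Suc l] @ Z))"
  using assms(3)
proof (induction l arbitrary: Z)
  case 0
  then show ?case by simp
next
  case (Suc l)
  let ?j = "Suc l"
  have b: "(r, ?j) \<in> boxes T" using Suc.prems assms by (simp add: mem_boxes)
  let ?N = "\<lambda>l. {j \<in> {1..l}. (r, j) \<notin> ones T \<and> Q (S r j) (E r j)}"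
  have u: "[1..<Suc ?j] = [1..<?j] @ [?j]" by simp
  have N: "?N ?j = ?N l \<union> (if (r, ?j) \<notin> ones T \<and> Q (S r ?j) (E r ?j) then {?j} else {})"
    by (auto simp: le_Suc_eq)
  let ?L = "map (S (Suc r)) [1..<?j] @ E r ?j # S r ?j # Z"
  let ?L' = "map (S (Suc r)) [1..<?j] @ S r ?j # E r ?j # Z"
  have start: "Row r # map (S r) [1..<Suc ?j] @ Z = Row r # map (S r) [1..<?j] @ S r ?j # Z"
    unfolding u by simp
  have IH: "pair_count (inverted Q) ?L =
      pair_count (inverted Q) (Row r # map (S r) [1..<?j] @ S r ?j # Z) + card (?N l)"
    "set ?L = set (Row r # map (S r) [1..<?j] @ S r ?j # Z)"
    "distinct ?L \<longleftrightarrow> distinct (Row r # map (S r) [1..<?j] @ S r ?j # Z)"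
    using Suc.IH[OF Suc_leD[OF Suc.prems], of "S r ?j # Z"] by blast+
  show ?case
  proof (cases "(r, ?j) \<in> ones T")
    case True
    have "map (S (Suc r)) [1..<Suc ?j] @ E r (Suc ?j) # Z = ?L" unfolding u using True by simp
    moreover have "?N ?j = ?N l" using N True by simp
    ultimately show ?thesis using IH unfolding start by (simp only: simp_thms)
  next
    case False
    have "map (S (Suc r)) [1..<Suc ?j] @ E r (Suc ?j) # Z = ?L'" unfolding u using False by simp
    moreover have "card (?N ?j) = card (?N l) + (if Q (S r ?j) (E r ?j) then 1 else 0)"
      unfolding N using False by auto
    moreover have "rank (E r ?j) < rank (S r ?j)" using zero_rank_less[OF b False] .
    then have "pair_count (inverted Q) ?L' =
        pair_count (inverted Q) ?L + (if Q (S r ?j) (E r ?j) then 1 else 0)"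
      by (subst pair_count_swap) (auto simp: inverted_def)
    moreover have "set ?L' = set ?L" "distinct ?L' \<longleftrightarrow> distinct ?L" by auto
    ultimately show ?thesis using IH unfolding start by (simp only:) simp
  qed
qed

text \<open>
  By condition (iii) these are the staircase rows without any \<open>1\<close>. The path from such a row runs straight
  through it, so that its crossings are kept out of the count of inversions.
\<close>

definition blank :: "nat \<Rightarrow> bool" where
  "blank r \<longleftrightarrow> 1 \<le> r \<and> r \<le> m \<and> (r, r) \<notin> ones T"

text \<open>
  The paths that take part in the permutation, as far as they start in the first \<open>i\<close> rows or at
  their diagonals. A staircase row and the column of its diagonal contribute one path between them:
  if the diagonal contains a \<open>1\<close>, the path from the column turns there and leaves at once.
\<close>

definition starts :: "nat \<Rightarrow> line set" where
  "starts i = Row ` {r \<in> {1..i}. \<not> blank r} \<union> Col ` {j \<in> {1..i}. blank j}"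

definition crossings :: "(line \<Rightarrow> line \<Rightarrow> bool) \<Rightarrow> nat \<Rightarrow> (nat \<times> nat) set" where
  "crossings Q i = {(r, j) \<in> zeros T. r \<le> i \<and> \<not> blank r \<and> Q (S r j) (E r j)}"

lemma card_crossings_Suc:
  assumes "Suc i \<le> n"
  shows "card (crossings Q (Suc i)) = card (crossings Q i) + (if blank (Suc i) then 0 else
    card {j \<in> {1..w (Suc i)}. (Suc i, j) \<notin> ones T \<and> Q (S (Suc i) j) (E (Suc i) j)})"
proof -
  let ?R = "{j \<in> {1..w (Suc i)}. (Suc i, j) \<notin> ones T \<and> Q (S (Suc i) j) (E (Suc i) j)}"
  have "crossings Q (Suc i) = crossings Q i \<union> (if blank (Suc i) then {} else Pair (Suc i) ` ?R)"
    using assms by (auto simp: crossings_def zeros_def mem_boxes le_Suc_eq)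
  moreover have "finite (crossings Q i)"
    by (rule finite_subset[OF _ finite_zeros]) (auto simp: crossings_def)
  moreover have "crossings Q i \<inter> Pair (Suc i) ` ?R = {}" by (auto simp: crossings_def)
  moreover have "card (Pair (Suc i) ` ?R) = card ?R" by (rule card_image) (simp add: inj_on_def)
  ultimately show ?thesis by (auto simp: card_Un_disjoint)
qed

text \<open>
  A new row is smaller in rank than everything in the word and is put first; the column of a blank
  diagonal is larger and is put last. Neither creates an inversion, so all of them come from zeros.
\<close>

lemma word_invariant:
  assumes "i \<le> n"
  shows "distinct (word i) \<and> set (word i) = starts i \<and>
    pair_count (inverted Q) (word i) = card (crossings Q i)"
  using assms
proof (induction i)
  case 0
  have "crossings Q 0 = {}" by (auto simp: crossings_def zeros_def mem_boxes)
  then show ?case by (simp add: word_def starts_def row_len_staircase)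
next
  case (Suc i)
  let ?r = "Suc i"
  have IH: "distinct (word i)" "set (word i) = starts i"
    "pair_count (inverted Q) (word i) = card (crossings Q i)" using Suc by auto
  note card = card_crossings_Suc[OF Suc.prems, of Q]
  have new: "distinct (Row ?r # word i)" "set (Row ?r # word i) = insert (Row ?r) (starts i)"
    "pair_count (inverted Q) (Row ?r # word i) = card (crossings Q i)"
    using IH by (auto simp: starts_def inverted_def filter_empty_conv)
  have starts: "starts ?r = insert (if blank ?r then Col ?r else Row ?r) (starts i)"
    by (auto simp: starts_def le_Suc_eq)
  consider "m \<le> i" | "i < m" "\<not> blank ?r" | "i < m" "blank ?r" by force
  then show ?case
  proof cases
    \<comment> \<open>A row of the rectangle; the columns that it does not reach are finished before it is passed.\<close>
    case 1
    let ?Z = "map path_start (map Col [Suc (w ?r)..<Suc (w i)] @ finished i)"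
    have le: "w ?r \<le> w i" using row_len_antimono[of i ?r] 1 Suc.prems by simp
    have "map (S ?r) [Suc (w ?r)..<Suc (w i)] = map (path_start \<circ> Col) [Suc (w ?r)..<Suc (w i)]"
      using path_start_Col[of ?r] 1 Suc.prems by auto
    then have i: "word i = map (S ?r) [1..<Suc (w ?r)] @ ?Z"
      using upt_split[of 1 "Suc (w ?r)" "Suc (w i)"] le by (simp add: word_def del: upt_Suc)
    have r: "word ?r = map (S (Suc ?r)) [1..<Suc (w ?r)] @ E ?r (Suc (w ?r)) # ?Z"
      using 1 path_start_Row[of ?r] Suc.prems by (simp add: word_def del: upt_Suc east.simps)
    have "\<not> blank ?r" using 1 by (simp add: blank_def)
    then show ?thesis
      using pass_row[of ?r "w ?r" Q ?Z] Suc.prems new card starts unfolding i[symmetric] r[symmetric]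
      by simp
  next
    \<comment> \<open>A staircase row with a \<open>1\<close> on the diagonal. Passing its first \<open>i\<close> boxes suffices: at the
      diagonal the path of the row turns south and takes the place of column \<open>Suc i\<close>.\<close>
    case 2
    have one: "(?r, ?r) \<in> ones T" using 2 by (simp add: blank_def)
    have w: "w ?r = ?r" "w i = i" using 2 row_len_staircase by auto
    have i: "word i = map (S ?r) [1..<?r] @ []"
      using 2 w by (simp add: word_def finished_staircase del: upt_Suc)
    have "word ?r = map (S (Suc ?r)) ([1..<?r] @ [?r])"
      using 2 w by (simp add: word_def finished_staircase)
    also have "\<dots> = map (S (Suc ?r)) [1..<?r] @ [E ?r ?r]"
      using one by (simp del: upt_Suc east.simps)
    finally have r: "word ?r = map (S (Suc ?r)) [1..<?r] @ E ?r ?r # []" .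
    have "{j \<in> {1..w ?r}. (?r, j) \<notin> ones T \<and> Q (S ?r j) (E ?r j)} =
      {j \<in> {1..i}. (?r, j) \<notin> ones T \<and> Q (S ?r j) (E ?r j)}"
      using one w by (auto simp: le_Suc_eq simp del: east.simps south.simps)
    then show ?thesis
      using pass_row[of ?r i Q "[]"] Suc.prems new card starts 2 w unfolding i[symmetric] r[symmetric]
      by (simp del: east.simps south.simps)
  next
    \<comment> \<open>A blank row lets all paths pass straight down.\<close>
    case 3
    have w: "w ?r = ?r" "w i = i" using 3 row_len_staircase by auto
    have no: "(?r, j) \<notin> ones T" for j using 3 blank_row[of ?r j] by (simp add: blank_def)
    have "word ?r = map (S (Suc ?r)) ([1..<?r] @ [?r])"
      using 3 w by (simp add: word_def finished_staircase)
    also have "\<dots> = map (S ?r) [1..<?r] @ [S ?r ?r]" using no by (simp del: upt_Suc)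
    also have "S ?r ?r = Col ?r" using 3 by (intro south_diag) auto
    also have "map (S ?r) [1..<?r] = word i"
      using 3 w by (simp add: word_def finished_staircase del: upt_Suc)
    finally have r: "word ?r = word i @ [Col ?r]" .
    have "filter (\<lambda>y. inverted Q y (Col ?r)) (word i) = []"
      using IH(2) by (auto simp: filter_empty_conv starts_def inverted_def)
    then show ?thesis using IH card starts 3 unfolding r
      by (auto simp: pair_count_snoc starts_def)
  qed
qed

lemma bij_path_start: "bij_betw path_start border (starts n)"
proof -
  have "distinct (map path_start (cut n))" "set (map path_start (cut n)) = starts n"
    using word_invariant[of n] map_path_start_cut by auto
  moreover have "set (cut n) = border" using cut_set_sorted[of n] m_le by (simp add: border_def)
  ultimately show ?thesis by (auto simp: bij_betw_def distinct_map)
qed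

lemma card_crossings:
  "card (crossings Q n) = card {(e, e') \<in> border \<times> border. lab e' < lab e \<and>
     rank (path_start e') < rank (path_start e) \<and> Q (path_start e) (path_start e')}"
proof -
  have "distinct (cut n)"
    using word_invariant[of n] map_path_start_cut by (metis distinct_map order_refl)
  moreover have "set (cut n) = border" "sorted_wrt (\<lambda>e e'. lab e' < lab e) (cut n)"
    using cut_set_sorted[of n] m_le by (simp_all add: border_def)
  ultimately have "pair_count (inverted Q) (map path_start (cut n)) = card {(e, e') \<in> border \<times> border. 
      lab e' < lab e \<and> inverted Q (path_start e) (path_start e')}"
    using pair_count_sorted[of "\<lambda>e e'. lab e' < lab e" "cut n" "inverted Q" path_start] by simp
  then show ?thesis
    using word_invariant[of n Q] map_path_start_cut by (simp add: inverted_def)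
qed

section \<open>The signed permutation\<close>

text \<open>
  For a line with label \<open>x\<close>, the start of the path whose end has label \<open>\<bar>\<zeta>(T)(x)\<bar>\<close>.
\<close>

fun signed_start :: "line \<Rightarrow> line" where
  "signed_start (Row i) = Row i"
| "signed_start (Col j) = (if (j, j) \<in> ones T then Row j else Col j)"

lemma bij_signed_start: "bij_betw signed_start border (starts n)"
proof -
  have "inj_on signed_start border"
    by (rule inj_onI) (auto simp: border_def split: if_splits)
  moreover have "signed_start ` border = starts n"
  proof
    show "signed_start ` border \<subseteq> starts n"
      using m_le by (auto simp: border_def starts_def blank_def)
    show "starts n \<subseteq> signed_start ` border"
    proof
      fix s assume "s \<in> starts n"
      then consider i where "s = Row i" "1 \<le> i" "i \<le> n" "\<not> blank i" | j where "s = Col j" "blank j"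
        by (auto simp: starts_def)
      then show "s \<in> signed_start ` border"
      proof cases
        case (1 i)
        then have "s = signed_start (if i \<le> m then Col i else Row i)" 
          "(if i \<le> m then Col i else Row i) \<in> border"
          by (auto simp: blank_def border_def)
        then show ?thesis by blast
      next
        case (2 j)
        then have "s = signed_start (Col j)" "Col j \<in> border" by (auto simp: blank_def border_def)
        then show ?thesis by blast
      qed
    qed
  qed
  ultimately show ?thesis by (simp add: bij_betw_def)
qed

text \<open>
  The map \<open>\<bar>\<zeta>(T)\<bar>\<close>, acting on lines in place of their labels; \<open>val\<close> below restores the sign.
\<close>

definition perm :: "line \<Rightarrow> line" where
  "perm l = inv_into border path_start (signed_start l)"

lemma bij_perm: "bij_betw perm border border"
  unfolding perm_def
  using bij_betw_trans[OF bij_signed_start bij_betw_inv_into[OF bij_path_start]]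
  by (simp add: o_def)

lemma path_start_perm: "l \<in> border \<Longrightarrow> path_start (perm l) = signed_start l"
  unfolding perm_def using bij_signed_start bij_path_start
  by (metis bij_betw_apply bij_betw_inv_into_right)

lemma perm_border: "l \<in> border \<Longrightarrow> perm l \<in> border"
  using bij_perm by (rule bij_betw_apply)

lemma perm_eqI: "l \<in> border \<Longrightarrow> e \<in> border \<Longrightarrow> path_start e = signed_start l \<Longrightarrow> e = perm l"
  using path_start_perm perm_border bij_path_start by (metis bij_betw_def inj_onD)

lemma ends_at_path_start:
  assumes "e \<in> border" shows "ends_at T (path_start e) e"
proof (cases e)
  case (Row i)
  then have i: "m < i" "i \<le> n" using assms by (auto simp: border_def)
  have "enters T (E i (Suc (w i))) East (i, Suc (w i))" using i by (intro enters_path) auto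
  moreover have "(i, Suc (w i)) \<notin> boxes T" by (simp add: mem_boxes)
  ultimately show ?thesis unfolding Row path_start_Row[OF i(2)] by (rule ends_at.intros)
next
  case (Col j)
  then have j: "1 \<le> j" "j \<le> m" using assms by (auto simp: border_def)
  \<comment> \<open>The first row that column \<open>j\<close> does not meet.\<close>
  define i where "i = (LEAST i. m < i \<and> (i = Suc n \<or> w i < j))"
  have i: "m < i" "i = Suc n \<or> w i < j" "i \<le> Suc n"
    unfolding i_def using LeastI[of "\<lambda>i. m < i \<and> (i = Suc n \<or> w i < j)" "Suc n"] m_le
      Least_le[of "\<lambda>i. m < i \<and> (i = Suc n \<or> w i < j)" "Suc n"] by auto
  have "(i - 1, j) \<in> boxes T"
  proof (cases "i - 1 \<le> m")
    case True
    then show ?thesis using i j row_len_staircase[of "i - 1"] by (auto simp: mem_boxes)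
  next
    case False
    then have "\<not> (m < i - 1 \<and> (i - 1 = Suc n \<or> w (i - 1) < j))"
      unfolding i_def by (intro not_less_Least) auto
    then show ?thesis using False i j by (auto simp: mem_boxes)
  qed
  then have "enters T (S i j) South (i, j)" using i j by (intro enters_path) auto
  moreover have "(i, j) \<notin> boxes T" using i by (auto simp: mem_boxes)
  ultimately show ?thesis unfolding Col path_start_Col[OF i(1,3,2)] by (rule ends_at.intros)
qed

text \<open>
  A path of the permutation cannot end at a staircase row: what leaves row \<open>i\<close> there is the path of
  column \<open>i\<close> or the path of the blank row \<open>i\<close> itself.
\<close>

lemma ends_at_signed_start:
  assumes "l \<in> border" shows "ends_at T (signed_start l) e \<longleftrightarrow> e = perm l"
proof
  assume "e = perm l"
  then show "ends_at T (signed_start l) e"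
    using ends_at_path_start[OF perm_border[OF assms]] path_start_perm[OF assms] by simp
next
  assume "ends_at T (signed_start l) e"
  then show "e = perm l"
  proof cases
    case (1 i j)
    from enters_imp_path[OF 1(2)] have *: "signed_start l = E i j" "1 \<le> i" "i \<le> n" "j = Suc (w i)"
      using 1(3) by (auto simp: mem_boxes)
    have "signed_start l \<in> starts n" using bij_signed_start assms by (rule bij_betw_apply)
    have "m < i"
    proof (rule ccontr)
      assume "\<not> m < i"
      then have i: "i \<le> m" "w i = i" using row_len_staircase by auto
      have "E i (Suc i) = (if (i, i) \<in> ones T then Col i else Row i)"
        using south_diag[of i i] i * blank_row[of i] by (auto intro: east_no_one)
      then show False using * i \<open>signed_start l \<in> starts n\<close> 
        by (auto simp: starts_def blank_def split: if_splits simp del: east.simps)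
    qed
    then show ?thesis using 1 * assms path_start_Row[of i] by (intro perm_eqI) (auto simp: border_def)
  next
    case (2 i j)
    from enters_imp_path[OF 2(2)]
    have *: "signed_start l = S i j" "1 \<le> j" "j \<le> m" "j \<le> i" "i \<le> Suc n" by auto
    have "m < i" using 2(3) * row_len_staircase[of i] m_le by (force simp: mem_boxes)
    moreover have "i = Suc n \<or> w i < j" using 2(3) * calculation by (auto simp: mem_boxes)
    ultimately have "path_start e = signed_start l" using path_start_Col[of i j] * 2 by simp
    then show ?thesis using 2 * assms by (intro perm_eqI) (auto simp: border_def)
  qed
qed

definition val :: "line \<Rightarrow> int" where
  "val l = (if \<exists>j. l = Col j \<and> (j, j) \<in> ones T then - lab (perm l) else lab (perm l))"

lemma lab_pos: "l \<in> border \<Longrightarrow> 0 < lab l"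
  using bij_betw_apply[OF bij_lab, of l] by simp

lemma lab_eq_iff: "l \<in> border \<Longrightarrow> l' \<in> border \<Longrightarrow> lab l = lab l' \<longleftrightarrow> l = l'"
  using inj_lab by (auto dest: inj_onD simp del: label.simps)

text \<open>
  Closing under \<open>x \<mapsto> -x\<close> only adds the choice of a sign. As labels of the border are positive and distinct,
  the graph is single-valued.
\<close>

lemma zeta_graph_border:
  "zeta_graph T x y \<Longrightarrow> \<exists>l\<in>border. \<exists>\<epsilon>\<in>{1, -1}. x = \<epsilon> * lab l \<and> y = \<epsilon> * val l"
proof (induction rule: zeta_graph.induct)
  case (positive_row i e)
  then have l: "Row i \<in> border" by (auto simp: border_def)
  then have "val (Row i) = lab e" using positive_row ends_at_signed_start[OF l, of e] by (simp add: val_def)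
  then show ?case using l by (intro bexI[of _ "Row i"] bexI[of _ 1]) auto
next
  case (diagonal_zero j e)
  then have l: "Col j \<in> border" by (auto simp: border_def)
  then have "val (Col j) = lab e" using diagonal_zero ends_at_signed_start[OF l, of e] by (simp add: val_def)
  then show ?case using l by (intro bexI[of _ "Col j"] bexI[of _ 1]) auto
next
  case (diagonal_one j e)
  then have l: "Col j \<in> border" by (auto simp: border_def)
  then have "val (Col j) = - lab e" using diagonal_one ends_at_signed_start[OF l, of e] by (simp add: val_def)
  then show ?case using l diagonal_one by (intro bexI[of _ "Col j"] bexI[of _ "-1"]) auto
next
  case (sign x y)
  then obtain l \<epsilon> where "l \<in> border" "\<epsilon> \<in> {1, -1}" "x = \<epsilon> * lab l" "y = \<epsilon> * val l" by blast
  then show ?case by (intro bexI[of _ l] bexI[of _ "- \<epsilon>"]) auto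
qed

lemma zeta_lab:
  assumes l: "l \<in> border" shows "zeta T (lab l) = val l"
proof -
  have ends: "ends_at T (signed_start l) (perm l)" using ends_at_signed_start[OF l] by simp
  have "zeta_graph T (lab l) (val l)"
  proof (cases l)
    case (Row i)
    then show ?thesis using positive_row[of i T "perm l"] ends l by (auto simp: border_def val_def)
  next
    case (Col j)
    then have j: "j \<in> {1..m}" using l by (auto simp: border_def)
    show ?thesis
    proof (cases "(j, j) \<in> ones T")
      case True
      then show ?thesis
        using sign[OF diagonal_one[OF j True, of "perm l"]] ends Col j by (simp add: val_def)
    next
      case False
      then show ?thesis
        using diagonal_zero[OF j False, of "perm l"] ends Col by (simp add: val_def)
    qed
  qed
  moreover have "y = val l" if y: "zeta_graph T (lab l) y" for y
  proof -
    obtain l' \<epsilon> where l': "l' \<in> border" "\<epsilon> \<in> {1, -1}" "lab l = \<epsilon> * lab l'" "y = \<epsilon> * val l'" 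
      using zeta_graph_border[OF y] by blast
    then have "\<epsilon> = 1" using lab_pos[OF l] lab_pos[OF l'(1)] by auto
    then show ?thesis using l' lab_eq_iff[OF l l'(1)] by simp
  qed
  ultimately have "(THE y. zeta_graph T (lab l) y) = val l" by (rule the_equality)
  moreover have "lab l \<noteq> 0 \<and> \<bar>lab l\<bar> \<le> int (len T)"
    using bij_betw_apply[OF bij_lab l] by simp
  ultimately show ?thesis by (simp add: zeta_def)
qed

text \<open>A path never moves up, so it ends in a row at or below row \<open>i\<close> or at a column meeting such a row.\<close>

lemma row_weak_excedance:
  assumes "Row i \<in> border" shows "lab (Row i) \<le> lab (perm (Row i))"
proof -
  let ?e = "perm (Row i)"
  have i: "m < i" "i \<le> n" using assms by (auto simp: border_def)
  have e: "?e \<in> border" "path_start ?e = Row i"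
    using perm_border path_start_perm assms by auto
  show ?thesis
  proof (cases ?e)
    case (Row r)
    then have "i \<le> r" using e east_south_range(1)[of r "Suc m" i] by (simp add: path_start_def)
    then show ?thesis using Row e i lab_Row_less_iff[of i r]
      by (cases "i = r") (auto simp: border_def simp del: label.simps)
  next
    case (Col c)
    then obtain r where r: "r \<ge> i" "(r, c) \<in> ones T"
      using e south_row[of "Suc n" c i] by (auto simp: path_start_def)
    then have "c \<le> w i" using onesD[of r c] row_len_antimono[of i r] i by auto
    then show ?thesis using Col e i lab_Row_less_Col_iff(1)[of i c]
      by (auto simp: border_def simp del: label.simps)
  qed
qed

text \<open>
  A path never moves left. As the column contains a \<open>1\<close>, the path leaves it for good, and ends either
  further right or in a row that meets column \<open>j\<close>.
\<close>

lemma col_anti_excedance: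
  assumes "Col j \<in> border" "(j, j) \<notin> ones T" shows "lab (perm (Col j)) < lab (Col j)"
proof -
  let ?e = "perm (Col j)"
  have j: "1 \<le> j" "j \<le> m" using assms by (auto simp: border_def)
  have e: "?e \<in> border" "path_start ?e = Col j"
    using perm_border path_start_perm[of "Col j"] assms by auto
  show ?thesis
  proof (cases ?e)
    case (Row r)
    then obtain c where "c \<ge> j" "(r, c) \<in> ones T"
      using e east_col[of r "Suc m" j] by (auto simp: path_start_def)
    then have "j \<le> w r" using onesD[of r c] by auto
    then show ?thesis using Row e j lab_Row_less_Col_iff(1)[of r j]
      by (auto simp: border_def simp del: label.simps)
  next
    case (Col c)
    then have c: "S (Suc n) c = Col j" using e by (simp add: path_start_def)
    then have "j \<le> c" by (rule east_south_range)
    moreover have "c \<noteq> j"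
    proof
      assume "c = j"
      moreover obtain i where "(i, j) \<in> ones T" using column_one j by blast
      ultimately show False using c south_eq_ColD[of "Suc n" j i] onesD[of i j] by auto
    qed
    ultimately show ?thesis using Col e j lab_Col_less_iff[of c j]
      by (auto simp: border_def simp del: label.simps)
  qed
qed

text \<open>
  The three kinds of arguments of \<open>\<zeta>(T)\<close>: row labels, column labels with negative image, and column
  labels with positive image.
\<close>

lemma border_cases:
  assumes "l \<in> border"
  obtains (row) i where "l = Row i" "m < i" "i \<le> n" "signed_start l = Row i" "\<not> blank i"
      "val l = lab (perm l)" "lab l \<le> lab (perm l)"
  | (negative) j where "l = Col j" "1 \<le> j" "j \<le> m" "signed_start l = Row j" "\<not> blank j"
      "val l = - lab (perm l)"
  | (positive) j where "l = Col j" "1 \<le> j" "j \<le> m" "signed_start l = Col j" "blank j"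
      "val l = lab (perm l)" "lab (perm l) < lab l"
proof (cases l)
  case (Row i)
  then show ?thesis using assms row_weak_excedance[of i]
    by (intro row) (auto simp: border_def val_def blank_def simp del: label.simps)
next
  case (Col j)
  show ?thesis
  proof (cases "(j, j) \<in> ones T")
    case True
    then show ?thesis using assms Col
      by (intro negative) (auto simp: border_def val_def blank_def simp del: label.simps)
  next
    case False
    then show ?thesis using assms Col col_anti_excedance[of j]
      by (intro positive) (auto simp: border_def val_def blank_def simp del: label.simps)
  qed
qed

lemma card_alignments:
  "card {(i, j). i \<in> {1..int n} \<and> j \<in> {1..int n} \<and> P i j (zeta T i) (zeta T j)} =
    card {(l, l') \<in> border \<times> border. P (lab l) (lab l') (val l) (val l')}"
proof -
  have "{(i, j). i \<in> {1..int n} \<and> j \<in> {1..int n} \<and> P i j (zeta T i) (zeta T j)} =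
      {(i, j) \<in> {1..int n} \<times> {1..int n}. P i j (zeta T i) (zeta T j)}" by auto
  moreover have "{(l, l') \<in> border \<times> border. P (lab l) (lab l') (zeta T (lab l)) (zeta T (lab l'))} =
      {(l, l') \<in> border \<times> border. P (lab l) (lab l') (val l) (val l')}"
    by (auto simp: zeta_lab simp del: label.simps)
  ultimately show ?thesis
    using card_pairs_bij[OF bij_lab, of "\<lambda>i j. P i j (zeta T i) (zeta T j)"] by simp
qed

text \<open>The inversions of the final word, indexed by the arguments of the permutation.\<close>

definition crossed :: "(line \<Rightarrow> line \<Rightarrow> bool) \<Rightarrow> line \<Rightarrow> line \<Rightarrow> bool" where
  "crossed Q l l' \<longleftrightarrow> lab (perm l') < lab (perm l) \<and>
     rank (signed_start l') < rank (signed_start l) \<and> Q (signed_start l) (signed_start l')"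

lemma card_crossed: "card (crossings Q n) = card {(l, l') \<in> border \<times> border. crossed Q l l'}"
proof -
  have "card (crossings Q n) = card {(l, l') \<in> border \<times> border. lab (perm l') < lab (perm l) \<and>
     rank (path_start (perm l')) < rank (path_start (perm l)) \<and>
     Q (path_start (perm l)) (path_start (perm l'))}"
    using card_crossings by (rule trans) (rule card_pairs_bij[OF bij_perm])
  also have "{(l, l') \<in> border \<times> border. lab (perm l') < lab (perm l) \<and>
     rank (path_start (perm l')) < rank (path_start (perm l)) \<and>
     Q (path_start (perm l)) (path_start (perm l'))} = {(l, l') \<in> border \<times> border. crossed Q l l'}"
    by (rule pairs_cong) (simp only: path_start_perm crossed_def)
  finally show ?thesis .
qed

lemma east_blank: "blank r \<Longrightarrow> E r j = Row r"
  using blank_row by (intro east_no_one) (auto simp: blank_def)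

section \<open>The statistics\<close>

lemma enters_kind_iff:
  assumes "(i, j) \<in> zeros T"
  shows "(\<exists>r. enters T (Row r) East (i, j)) \<longleftrightarrow> is_row (E i j)"
    "(\<exists>r. enters T (Row r) South (i, j)) \<longleftrightarrow> is_row (S i j)"
    "(\<exists>c. enters T (Col c) East (i, j)) \<longleftrightarrow> \<not> is_row (E i j)"
    "(\<exists>c. enters T (Col c) South (i, j)) \<longleftrightarrow> \<not> is_row (S i j)"
proof -
  have "(i, j) \<in> boxes T" using assms by (simp add: zeros_def)
  note iff = enters_box_iff[OF this]
  show "(\<exists>r. enters T (Row r) East (i, j)) \<longleftrightarrow> is_row (E i j)"
    "(\<exists>c. enters T (Col c) East (i, j)) \<longleftrightarrow> \<not> is_row (E i j)"
    unfolding iff by (cases "E i j"; simp)+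
  show "(\<exists>r. enters T (Row r) South (i, j)) \<longleftrightarrow> is_row (S i j)"
    "(\<exists>c. enters T (Col c) South (i, j)) \<longleftrightarrow> \<not> is_row (S i j)"
    unfolding iff by (cases "S i j"; simp)+
qed

lemma zeros_eqI:
  assumes "\<And>i j. (i, j) \<in> zeros T \<Longrightarrow> P (i, j) \<longleftrightarrow> Q i j"
  shows "{b \<in> zeros T. P b} = {(i, j) \<in> zeros T. Q i j}"
  using assms by auto

lemma crossings_n: "crossings Q n = {(r, j) \<in> zeros T. \<not> blank r \<and> Q (S r j) (E r j)}"
  by (auto simp: crossings_def zeros_def mem_boxes)

lemma zero_NN_eq: "zero_NN T = card (crossings (\<lambda>s s'. \<not> is_row s \<and> \<not> is_row s') n)"
proof -
  have "{b \<in> zeros T. (\<exists>c. enters T (Col c) East b) \<and> (\<exists>c. enters T (Col c) South b)} =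
      crossings (\<lambda>s s'. \<not> is_row s \<and> \<not> is_row s') n"
    unfolding crossings_n by (rule zeros_eqI) (auto simp: enters_kind_iff east_blank)
  then show ?thesis by (simp add: zero_NN_def)
qed

lemma zero_EN_eq: "zero_EN T = card (crossings (\<lambda>s s'. is_row s \<noteq> is_row s') n)"
proof -
  have blank: "label T (Row i) < 0 \<and> (\<forall>j'. (i, j') \<notin> ones T) \<longleftrightarrow> blank i" if "(i, j) \<in> zeros T" for i j
    using that blank_row[of i] by (auto simp: blank_def zeros_def mem_boxes col_label_def)
  have kinds: "((\<exists>r c. enters T (Row r) East (i, j) \<and> enters T (Col c) South (i, j)) \<or>
      (\<exists>r c. enters T (Col c) East (i, j) \<and> enters T (Row r) South (i, j))) \<longleftrightarrow>
      is_row (S i j) \<noteq> is_row (E i j)" if "(i, j) \<in> zeros T" for i j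
  proof -
    have "((\<exists>r c. enters T (Row r) East (i, j) \<and> enters T (Col c) South (i, j)) \<or>
      (\<exists>r c. enters T (Col c) East (i, j) \<and> enters T (Row r) South (i, j))) \<longleftrightarrow>
      ((\<exists>r. enters T (Row r) East (i, j)) \<and> (\<exists>c. enters T (Col c) South (i, j))) \<or>
      ((\<exists>c. enters T (Col c) East (i, j)) \<and> (\<exists>r. enters T (Row r) South (i, j)))" by blast
    then show ?thesis unfolding enters_kind_iff[OF that] by blast
  qed
  have "{(i, j) \<in> zeros T.
     \<not> (label T (Row i) < 0 \<and> (\<forall>j'. (i, j') \<notin> ones T)) \<and>
     ((\<exists>r c. enters T (Row r) East (i, j) \<and> enters T (Col c) South (i, j)) \<or>
      (\<exists>r c. enters T (Col c) East (i, j) \<and> enters T (Row r) South (i, j)))} =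
    crossings (\<lambda>s s'. is_row s \<noteq> is_row s') n"
    (is "{(i, j) \<in> zeros T. ?P i j} = _")
  proof -
    have "{b \<in> zeros T. case b of (i, j) \<Rightarrow> ?P i j} = crossings (\<lambda>s s'. is_row s \<noteq> is_row s') n"
      unfolding crossings_n
    proof (rule zeros_eqI, unfold prod.case)
      fix i j assume z: "(i, j) \<in> zeros T"
      show "?P i j \<longleftrightarrow> \<not> blank i \<and> is_row (S i j) \<noteq> is_row (E i j)"
        unfolding blank[OF z] kinds[OF z] ..
    qed
    moreover have "{(i, j) \<in> zeros T. ?P i j} = {b \<in> zeros T. case b of (i, j) \<Rightarrow> ?P i j}"
      by (rule Collect_cong) (simp only: split_beta prod.collapse)
    ultimately show ?thesis by (simp only:)
  qed
  then show ?thesis unfolding zero_EN_def by (simp only:)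
qed

fun index :: "line \<Rightarrow> nat" where
  "index (Row i) = i"
| "index (Col j) = j"

text \<open>
  The paths that come down into a blank row \<open>b\<close> are all those that have started above it, each in
  its own column. Those among them that start in a row come from the staircase rows
  \<open>a < b\<close> that are not blank.
\<close>

lemma card_blank_row_crossings:
  "card {(r, j) \<in> zeros T. blank r \<and> is_row (S r j)} =
   card {(Col a, Col b) | a b. 1 \<le> a \<and> a < b \<and> \<not> blank a \<and> blank b}" (is "card ?Z = card ?P")
proof -
  have bij: "bij_betw (S r) {1..<r} (starts (r - 1))" if "blank r" for r
  proof -
    have r: "1 \<le> r" "r \<le> m" using that by (auto simp: blank_def)
    then have "word (r - 1) = map (S r) [1..<r]"
      by (simp add: word_def finished_staircase row_len_staircase del: upt_Suc)
    then show ?thesis using word_invariant[of "r - 1"] r m_le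
      by (auto simp: bij_betw_def distinct_map)
  qed
  have Z: "(r, j) \<in> ?Z \<longleftrightarrow> blank r \<and> j \<in> {1..<r} \<and> is_row (S r j)" for r j
  proof
    assume *: "(r, j) \<in> ?Z"
    then have r: "1 \<le> r" "r \<le> m" by (auto simp: blank_def)
    then have "j \<le> r" using * row_len_staircase[of r] by (auto simp: zeros_def mem_boxes)
    moreover have "j \<noteq> r" using * south_diag[of r r] r by auto
    ultimately show "blank r \<and> j \<in> {1..<r} \<and> is_row (S r j)"
      using * by (auto simp: zeros_def mem_boxes)
  next
    assume *: "blank r \<and> j \<in> {1..<r} \<and> is_row (S r j)"
    then have "1 \<le> r" "r \<le> m" "(r, r) \<notin> ones T" by (auto simp: blank_def)
    then show "(r, j) \<in> ?Z" using * blank_row[of r j] m_le row_len_staircase[of r]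
      by (auto simp: zeros_def mem_boxes)
  qed
  let ?f = "\<lambda>(r, j). (Col (index (S r j)), Col r)"
  have inj: "inj_on ?f ?Z"
  proof (rule inj_onI)
    fix b b' assume *: "b \<in> ?Z" "b' \<in> ?Z" and eq: "?f b = ?f b'"
    obtain r j r' j' where b: "b = (r, j)" "b' = (r', j')" by (cases b; cases b')
    then have r: "r' = r" and ind: "index (S r j) = index (S r j')" using eq by auto
    have rj: "blank r" "j \<in> {1..<r}" "is_row (S r j)" "j' \<in> {1..<r}" "is_row (S r j')"
      using * Z[of r j] Z[of r j'] unfolding b r by simp_all
    then have "S r j = S r j'" using ind by (cases "S r j"; cases "S r j'") auto
    then have "j = j'" using bij[OF rj(1)] rj by (meson bij_betw_imp_inj_on inj_onD)
    then show "b = b'" using b r by simp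
  qed
  have img: "?f ` ?Z = ?P"
  proof
    show "?f ` ?Z \<subseteq> ?P"
    proof (rule image_subsetI)
      fix b assume "b \<in> ?Z"
      moreover obtain r j where "b = (r, j)" by (cases b)
      ultimately have b: "b = (r, j)" "blank r" "j \<in> {1..<r}" "is_row (S r j)"
        using Z[of r j] by simp_all
      moreover have "S r j \<in> starts (r - 1)" using bij[OF b(2)] b(3) by (rule bij_betw_apply)
      ultimately show "?f b \<in> ?P" by (auto simp: starts_def)
    qed
    show "?P \<subseteq> ?f ` ?Z"
    proof
      fix p assume "p \<in> ?P"
      then obtain a r where p: "p = (Col a, Col r)" "1 \<le> a" "a < r" "\<not> blank a" "blank r" by auto
      then have "Row a \<in> starts (r - 1)" by (auto simp: starts_def)
      then obtain j where j: "j \<in> {1..<r}" "S r j = Row a"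
        using bij[OF p(5)] by (metis bij_betw_def imageE)
      then have "(r, j) \<in> ?Z" using Z p by simp
      then show "p \<in> ?f ` ?Z" using p j by force
    qed
  qed
  show ?thesis using card_image[OF inj] unfolding img ..
qed

lemma zero_EE_eq:
  "zero_EE T = card (crossings (\<lambda>s s'. is_row s \<and> is_row s') n) +
    card {(Col a, Col b) | a b. 1 \<le> a \<and> a < b \<and> \<not> blank a \<and> blank b}"
proof -
  have "{b \<in> zeros T. (\<exists>r. enters T (Row r) East b) \<and> (\<exists>r. enters T (Row r) South b)} =
      {(r, j) \<in> zeros T. is_row (E r j) \<and> is_row (S r j)}"
    by (rule zeros_eqI) (simp add: enters_kind_iff)
  also have "\<dots> = crossings (\<lambda>s s'. is_row s \<and> is_row s') n \<union>
      {(r, j) \<in> zeros T. blank r \<and> is_row (S r j)}"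
    unfolding crossings_n by (auto simp: east_blank)
  finally have "{b \<in> zeros T. (\<exists>r. enters T (Row r) East b) \<and> (\<exists>r. enters T (Row r) South b)} =
      crossings (\<lambda>s s'. is_row s \<and> is_row s') n \<union> {(r, j) \<in> zeros T. blank r \<and> is_row (S r j)}" .
  moreover have "crossings (\<lambda>s s'. is_row s \<and> is_row s') n \<inter>
      {(r, j) \<in> zeros T. blank r \<and> is_row (S r j)} = {}" by (auto simp: crossings_def)
  moreover have "finite (crossings (\<lambda>s s'. is_row s \<and> is_row s') n)"
      "finite {(r, j) \<in> zeros T. blank r \<and> is_row (S r j)}"
    by (rule finite_subset[OF _ finite_zeros]; auto simp: crossings_def)+
  ultimately show ?thesis
    unfolding zero_EE_def card_blank_row_crossings[symmetric] by (simp add: card_Un_disjoint)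
qed

text \<open>
  By kinds of the two paths, nestings are inversions between two rows, inversions between two
  columns, listed in the opposite order, or pairs counted by the zeros of blank rows. Which alternative of the
  definition applies is then decided by the signs of the two images.
\<close>

lemma al_nest_eq: "al_nest n (zeta T) = zero_EE T + zero_NN T"
proof -
  let ?c = "\<lambda>i j a b :: int. (- i < - j \<and> - j < - b \<and> - b < - a) \<or>
      (- i < j \<and> j \<le> b \<and> b < - a) \<or> (i < j \<and> j \<le> b \<and> b < a)"
  let ?EE = "crossed (\<lambda>s s'. is_row s \<and> is_row s')"
  let ?NN = "crossed (\<lambda>s s'. \<not> is_row s \<and> \<not> is_row s')"
  let ?P = "\<lambda>l l'. \<exists>a b. l = Col a \<and> l' = Col b \<and> 1 \<le> a \<and> a < b \<and> \<not> blank a \<and> blank b"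
  let ?A = "{(l, l') \<in> border \<times> border. ?c (lab l) (lab l') (val l) (val l')}"
  have iff: "?c (lab l) (lab l') (val l) (val l') \<longleftrightarrow> ?EE l l' \<or> ?NN l' l \<or> ?P l l'"
    if l: "l \<in> border" "l' \<in> border" for l l'
  proof -
    note pos = lab_pos[OF perm_border[OF l(1)]] lab_pos[OF perm_border[OF l(2)]]
      lab_pos[OF l(1)] lab_pos[OF l(2)]
    from l(1) show ?thesis
    proof (cases rule: border_cases)
      case (row i)
      note l_case = row
      from l(2) show ?thesis
      proof (cases rule: border_cases)
        case (row i')
        show ?thesis using l pos l_case row lab_Row_less_iff[of i i']
          by (auto simp: crossed_def simp del: label.simps)
      next
        case (negative j')
        show ?thesis using l pos l_case negative
          by (auto simp: crossed_def simp del: label.simps)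
      next
        case (positive j')
        show ?thesis using l pos l_case positive
          by (auto simp: crossed_def simp del: label.simps)
      qed
    next
      case (negative j)
      note l_case = negative
      from l(2) show ?thesis
      proof (cases rule: border_cases)
        case (row i')
        show ?thesis using l pos l_case row
          by (auto simp: crossed_def simp del: label.simps)
      next
        case (negative j')
        show ?thesis using l pos l_case negative lab_Col_less_iff[of j' j]
          by (auto simp: crossed_def simp del: label.simps)
      next
        case (positive j')
        show ?thesis using l pos l_case positive lab_Col_less_iff[of j' j]
          by (auto simp: crossed_def simp del: label.simps)
      qed
    next
      case (positive j)
      note l_case = positive
      from l(2) show ?thesis
      proof (cases rule: border_cases)
        case (row i')
        show ?thesis using l pos l_case row
          by (auto simp: crossed_def simp del: label.simps)
      next
        case (negative j')
        show ?thesis using l pos l_case negative lab_Col_less_iff[of j' j]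
          by (auto simp: crossed_def simp del: label.simps)
      next
        case (positive j')
        show ?thesis using l pos l_case positive lab_Col_less_iff[of j' j]
          by (auto simp: crossed_def simp del: label.simps)
      qed
    qed
  qed
  have "card ?A = card {(l, l') \<in> border \<times> border. ?EE l l' \<or> ?NN l' l \<or> ?P l l'}"
    by (intro arg_cong[of _ _ card] pairs_cong) (fact iff)
  also have "\<dots> = card {(l, l') \<in> border \<times> border. ?EE l l'} +
      card {(l, l') \<in> border \<times> border. ?NN l' l \<or> ?P l l'}"
    by (rule card_pairs_disj[OF finite_border])
      (auto simp: crossed_def blank_def simp del: label.simps split: if_splits)
  also have "card {(l, l') \<in> border \<times> border. ?NN l' l \<or> ?P l l'} =
      card {(l, l') \<in> border \<times> border. ?NN l' l} + card {(l, l') \<in> border \<times> border. ?P l l'}"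
    by (rule card_pairs_disj[OF finite_border])
      (auto simp: crossed_def blank_def simp del: label.simps split: if_splits)
  also have "card {(l, l') \<in> border \<times> border. ?NN l' l} = card {(l, l') \<in> border \<times> border. ?NN l l'}"
    by (rule card_pairs_swap)
  also have "{(l, l') \<in> border \<times> border. ?P l l'} =
      {(Col a, Col b) | a b. 1 \<le> a \<and> a < b \<and> \<not> blank a \<and> blank b}"
    by (auto simp: border_def blank_def)
  finally have A: "card ?A = zero_EE T + zero_NN T"
    unfolding zero_EE_eq zero_NN_eq card_crossed by (simp only: ac_simps)
  show ?thesis
    unfolding al_nest_def card_alignments[of ?c] by (fact A)
qed

lemma al_EN_eq: "al_EN n (zeta T) = zero_EN T"
proof -
  let ?c = "\<lambda>i j a b :: int. (- i < 0 \<and> 0 < - a \<and> - a < b \<and> b < j) \<or> (i \<le> a \<and> a < b \<and> b < j)"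
  let ?A = "{(l, l') \<in> border \<times> border. ?c (lab l) (lab l') (val l) (val l')}"
  have iff: "?c (lab l) (lab l') (val l) (val l') \<longleftrightarrow> crossed (\<lambda>s s'. is_row s \<noteq> is_row s') l' l"
    if l: "l \<in> border" "l' \<in> border" for l l'
  proof -
    note pos = lab_pos[OF perm_border[OF l(1)]] lab_pos[OF perm_border[OF l(2)]]
      lab_pos[OF l(1)] lab_pos[OF l(2)]
    from l(1) show ?thesis
      by (cases rule: border_cases; use l(2) in \<open>cases rule: border_cases\<close>)
        (use pos in \<open>auto simp: crossed_def simp del: label.simps\<close>)
  qed
  have "?A = {(l, l') \<in> border \<times> border. crossed (\<lambda>s s'. is_row s \<noteq> is_row s') l' l}"
    by (rule pairs_cong) (fact iff)
  then have A: "card ?A = zero_EN T"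
    unfolding zero_EN_eq card_crossed by (simp only:) (rule card_pairs_swap)
  show ?thesis
    unfolding al_EN_def card_alignments[of ?c] by (fact A)
qed

lemma al_NE_eq: "al_NE n (zeta T) = two T"
proof -
  let ?c = "\<lambda>i j a b :: int. a < i \<and> i < j \<and> j \<le> b"
  let ?A = "{(l, l') \<in> border \<times> border. ?c (lab l) (lab l') (val l) (val l')}"
  let ?B = "{m<..n} \<times> {1..m} - boxes T"
  let ?f = "\<lambda>(r, j). (Col j, Row r)"
  have exc: "val l < lab l \<longleftrightarrow> \<not> is_row l" if l: "l \<in> border" for l
    using l by (cases rule: border_cases)
      (use lab_pos[OF l] lab_pos[OF perm_border[OF l]] in \<open>auto simp del: label.simps\<close>)
  have "?c (lab l) (lab l') (val l) (val l') \<longleftrightarrow> (\<exists>r j. l = Col j \<and> l' = Row r \<and> (r, j) \<in> ?B)"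
    if l: "l \<in> border" "l' \<in> border" for l l'
  proof -
    have "?c (lab l) (lab l') (val l) (val l') \<longleftrightarrow> \<not> is_row l \<and> is_row l' \<and> lab l < lab l'"
      using exc[OF l(1)] exc[OF l(2)] by linarith
    then show ?thesis using l lab_Row_less_Col_iff(2)
      by (cases l; cases l') (auto simp: border_def mem_boxes simp del: label.simps)
  qed
  then have "?A = {(l, l') \<in> border \<times> border. \<exists>r j. l = Col j \<and> l' = Row r \<and> (r, j) \<in> ?B}"
    by (rule pairs_cong)
  also have "\<dots> = ?f ` ?B" by (force simp: border_def)
  finally have "?A = ?f ` ?B" .
  moreover have "card (?f ` ?B) = card ?B" by (rule card_image) (auto simp: inj_on_def)
  ultimately show ?thesis
    unfolding al_NE_def card_alignments[of ?c] two_def by (simp only: len_T)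
qed

end

theorem proposition3p2:
  fixes n :: nat and T :: filling
  assumes "n \<ge> 1" and "T \<in> PTB n"
  shows "al_nest n (zeta T) = zero_EE T + zero_NN T \<and>
         al_EN n (zeta T) = zero_EN T \<and>
         al_NE n (zeta T) = two T"
proof -
  interpret tableau n T using assms(2) by unfold_locales
  show ?thesis using al_nest_eq al_EN_eq al_NE_eq by simp
qed

end
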